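(* Let $(M,J)$ be an almost complex manifold of real dimension 6 and let $\Phi_\alpha$, $\alpha=1,\dots,15$, be a family of pseudoholomorphic foliations of $M$ of real dimension 4. If this family is quadratically non-degenerate, then $J$ is integrable.
   Context: All considerations are local. An almost complex structure on $M$ is a field $J$ of endomorphisms of $TM$ with $J^2=-\mathbf 1$; it makes each $T_xM$ a complex vector space, here of complex dimension 3. A pseudoholomorphic (PH) foliation is a foliation whose leaves have $J$-invariant tangent spaces. For a PH-foliation $\Phi_\alpha$ of real dimension 4, $T_x\Phi_\alpha$ denotes the tangent space at $x$ of the leaf through $x$; it is a point of the Grassmannian $\mathrm{Gr}_2(T_xM,\mathbb C)\simeq\mathbb CP^2$ of complex 2-planes. The family $\{\Phi_\alpha\}$ is called quadratically non-degenerate if at almost every point $x\in M$ the points $T_x\Phi_\alpha\in \mathrm{Gr}_2(T_xM,\mathbb C)\simeq \mathbb CP^2$ do not all belong to any one real quadric of (real) codimension 1. Here a real quadric of codimension 1 is the zero locus, in an affine chart $\mathbb C^2\cong\mathbb R^4$ of $\mathbb CP^2$ containing the points in question, of a single nonzero real polynomial of degree at most 2 in the 4 real coordinates (such polynomials have 15 coefficients, so any 14 points of $\mathbb CP^2$ do belong to a real quadric). $J$ is integrable if near every point there are local coordinates in which it is the standard complex structure; equivalently, its Nijenhuis tensor $N_J(\xi,\eta)=[J\xi,J\eta]-J[\xi,J\eta]-J[J\xi,\eta]-[\xi,\eta]$ vanishes identically. *)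

theory Defs
  imports "HOL-Analysis.Analysis"
begin

(* C^k maps; the set S is always open where these are used. *)

primrec Ck_on :: "nat \<Rightarrow> 'a::euclidean_space set \<Rightarrow> ('a \<Rightarrow> 'b::real_normed_vector) \<Rightarrow> bool" where
  "Ck_on 0 S f \<longleftrightarrow> continuous_on S f"
| "Ck_on (Suc k) S f \<longleftrightarrow> (\<forall>x\<in>S. f differentiable (at x)) \<and>
     (\<forall>v. Ck_on k S (\<lambda>x. frechet_derivative f (at x) v))"

definition smooth_on :: "'a::euclidean_space set \<Rightarrow> ('a \<Rightarrow> 'b::real_normed_vector) \<Rightarrow> bool" where
  "smooth_on S f \<longleftrightarrow> (\<forall>k. Ck_on k S f)"

(* A chart is a pair (domain, coordinate map). The manifold is the whole type 'm. *)

type_synonym ('m, 'e) chart = "'m set \<times> ('m \<Rightarrow> 'e)"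

definition chart_inv :: "('m, 'e) chart \<Rightarrow> 'e \<Rightarrow> 'm" where
  "chart_inv c = inv_into (fst c) (snd c)"

definition is_chart :: "('m::topological_space, 'e::euclidean_space) chart \<Rightarrow> bool" where
  "is_chart c \<longleftrightarrow> open (fst c) \<and> open (snd c ` fst c) \<and>
     homeomorphism (fst c) (snd c ` fst c) (snd c) (chart_inv c)"

definition transition :: "('m, 'e) chart \<Rightarrow> ('m, 'f) chart \<Rightarrow> 'e \<Rightarrow> 'f" where
  "transition c c' = snd c' \<circ> chart_inv c"

definition smoothly_compatible ::
    "('m, 'e::euclidean_space) chart \<Rightarrow> ('m, 'f::euclidean_space) chart \<Rightarrow> bool" where
  "smoothly_compatible c c' \<longleftrightarrow>
     smooth_on (snd c ` (fst c \<inter> fst c')) (transition c c') \<and>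
     smooth_on (snd c' ` (fst c \<inter> fst c')) (transition c' c)"

definition smooth_atlas :: "('m::topological_space, 'e::euclidean_space) chart set \<Rightarrow> bool" where
  "smooth_atlas A \<longleftrightarrow> (\<forall>c\<in>A. is_chart c) \<and> (\<Union>c\<in>A. fst c) = UNIV \<and>
     (\<forall>c\<in>A. \<forall>c'\<in>A. smoothly_compatible c c')"

(* A field of endomorphisms of the tangent bundle is given by its coordinate expressions:
   J c y is the endomorphism in the chart c at the point with coordinates y. The last clause
   is the transformation law, which says that the J c are expressions of one (1,1)-tensor field. *)

definition almost_complex_structure ::
    "('m::topological_space, 'e::euclidean_space) chart set \<Rightarrow>
     (('m, 'e) chart \<Rightarrow> 'e \<Rightarrow> 'e \<Rightarrow> 'e) \<Rightarrow> bool" where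
  "almost_complex_structure A J \<longleftrightarrow>
     (\<forall>c\<in>A. \<forall>y\<in>snd c ` fst c. linear (J c y) \<and> (\<forall>v. J c y (J c y v) = - v)) \<and>
     (\<forall>c\<in>A. \<forall>v. smooth_on (snd c ` fst c) (\<lambda>y. J c y v)) \<and>
     (\<forall>c\<in>A. \<forall>c'\<in>A. \<forall>y\<in>snd c ` (fst c \<inter> fst c'). \<forall>v.
        J c' (transition c c' y) (frechet_derivative (transition c c') (at y) v) =
        frechet_derivative (transition c c') (at y) (J c y v))"

definition lie_bracket :: "('e::euclidean_space \<Rightarrow> 'e) \<Rightarrow> ('e \<Rightarrow> 'e) \<Rightarrow> 'e \<Rightarrow> 'e" where
  "lie_bracket X Y y = frechet_derivative Y (at y) (X y) - frechet_derivative X (at y) (Y y)"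

definition nijenhuis ::
    "('e::euclidean_space \<Rightarrow> 'e \<Rightarrow> 'e) \<Rightarrow> ('e \<Rightarrow> 'e) \<Rightarrow> ('e \<Rightarrow> 'e) \<Rightarrow> 'e \<Rightarrow> 'e" where
  "nijenhuis j X Y y =
     lie_bracket (\<lambda>u. j u (X u)) (\<lambda>u. j u (Y u)) y
     - j y (lie_bracket X (\<lambda>u. j u (Y u)) y)
     - j y (lie_bracket (\<lambda>u. j u (X u)) Y y)
     - lie_bracket X Y y"

(* Integrability as vanishing of the Nijenhuis tensor on vector fields over chart domains; by the
   Newlander-Nirenberg theorem this is the existence of local holomorphic coordinates. *)

definition integrable_structure ::
    "('m::topological_space, 'e::euclidean_space) chart set \<Rightarrow>
     (('m, 'e) chart \<Rightarrow> 'e \<Rightarrow> 'e \<Rightarrow> 'e) \<Rightarrow> bool" where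
  "integrable_structure A J \<longleftrightarrow>
     (\<forall>c\<in>A. \<forall>X Y. smooth_on (snd c ` fst c) X \<longrightarrow> smooth_on (snd c ` fst c) Y \<longrightarrow>
        (\<forall>y\<in>snd c ` fst c. nijenhuis (J c) X Y y = 0))"

(* A foliation is given by its set of leaves. Path-connectedness (rather than connectedness)
   prevents a dense leaf from being merged with other leaves contained in its closure. *)

definition foliation_4_6 ::
    "('m::topological_space, real^6) chart set \<Rightarrow> 'm set set \<Rightarrow> bool" where
  "foliation_4_6 A F \<longleftrightarrow>
     \<Union>F = UNIV \<and> pairwise disjnt F \<and> (\<forall>L\<in>F. L \<noteq> {} \<and> path_connected L) \<and>
     (\<forall>x. \<exists>f :: ('m, (real^4) \<times> (real^2)) chart.
        is_chart f \<and> x \<in> fst f \<and> (\<forall>c\<in>A. smoothly_compatible c f) \<and>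
        (\<forall>L\<in>F. \<forall>C\<in>components (L \<inter> fst f). \<exists>t. C = {p \<in> fst f. snd (snd f p) = t}))"

definition leaf_through :: "'m set set \<Rightarrow> 'm \<Rightarrow> 'm set" where
  "leaf_through F x = (THE L. L \<in> F \<and> x \<in> L)"

(* The tangent space at x of a subset L, in the chart c: velocities of smooth curves lying in L.
   For a leaf L of a foliation these are exactly the vectors tangent to the leaf. *)

definition tangent_space ::
    "('m, 'e::euclidean_space) chart \<Rightarrow> 'm set \<Rightarrow> 'm \<Rightarrow> 'e set" where
  "tangent_space c L x = {v. \<exists>(\<gamma> :: real \<Rightarrow> 'm) \<epsilon>. \<epsilon> > 0 \<and> \<gamma> 0 = x \<and>
     \<gamma> ` {-\<epsilon><..<\<epsilon>} \<subseteq> L \<inter> fst c \<and> smooth_on {-\<epsilon><..<\<epsilon>} (snd c \<circ> \<gamma>) \<and>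
     ((snd c \<circ> \<gamma>) has_vector_derivative v) (at 0)}"

definition ph_foliation ::
    "('m::topological_space, real^6) chart set \<Rightarrow>
     (('m, real^6) chart \<Rightarrow> real^6 \<Rightarrow> real^6 \<Rightarrow> real^6) \<Rightarrow> 'm set set \<Rightarrow> bool" where
  "ph_foliation A J F \<longleftrightarrow> foliation_4_6 A F \<and>
     (\<forall>L\<in>F. \<forall>c\<in>A. \<forall>x\<in>L \<inter> fst c.
        J c (snd c x) ` tangent_space c L x \<subseteq> tangent_space c L x)"

definition cscale :: "('e \<Rightarrow> 'e) \<Rightarrow> complex \<Rightarrow> 'e::real_vector \<Rightarrow> 'e" where
  "cscale j w v = Re w *\<^sub>R v + Im w *\<^sub>R j v"

definition complex_basis3 :: "('e \<Rightarrow> 'e) \<Rightarrow> 'e \<Rightarrow> 'e \<Rightarrow> 'e::real_vector \<Rightarrow> bool" where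
  "complex_basis3 j e1 e2 e3 \<longleftrightarrow>
     bij (\<lambda>(w1, w2, w3). cscale j w1 e1 + cscale j w2 e2 + cscale j w3 e3)"

(* Inverse of the affine chart of the Grassmannian of complex 2-planes attached to the basis
   e1, e2, e3: the planes P with e3 \<notin> P correspond one-to-one to (z1, z2), via
   P = span_C {e1 + z1 e3, e2 + z2 e3}. All affine charts of CP^2 arise in this way. *)

definition gr2_plane ::
    "('e \<Rightarrow> 'e) \<Rightarrow> 'e \<Rightarrow> 'e \<Rightarrow> 'e \<Rightarrow> complex \<times> complex \<Rightarrow> 'e::real_vector set" where
  "gr2_plane j e1 e2 e3 z =
     {cscale j w1 (e1 + cscale j (fst z) e3) + cscale j w2 (e2 + cscale j (snd z) e3) | w1 w2. True}"

definition real_coords :: "complex \<times> complex \<Rightarrow> real^4" where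
  "real_coords z = vector [Re (fst z), Im (fst z), Re (snd z), Im (snd z)]"

(* Zero loci of the nonzero polynomials a + b.u + u.Cu of degree at most 2 on R^4; with C
   symmetric, the 1 + 4 + 10 = 15 entries are determined by the polynomial. *)

definition real_quadrics :: "(real^4) set set" where
  "real_quadrics = {{u. a + b \<bullet> u + u \<bullet> (C *v u) = 0} | a b C.
     transpose C = C \<and> \<not> (a = 0 \<and> b = 0 \<and> C = 0)}"

(* In an affine chart containing all the planes P i, they do not belong to one real quadric.
   (The degree of a real polynomial is not invariant under projective changes of chart;
   requiring the condition in every chart would be far more restrictive.) *)

definition planes_quadratically_nondegenerate ::
    "('e \<Rightarrow> 'e) \<Rightarrow> 'i set \<Rightarrow> ('i \<Rightarrow> 'e::real_vector set) \<Rightarrow> bool" where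
  "planes_quadratically_nondegenerate j I P \<longleftrightarrow>
     (\<exists>e1 e2 e3 z. complex_basis3 j e1 e2 e3 \<and>
        (\<forall>i\<in>I. P i = gr2_plane j e1 e2 e3 (z i)) \<and>
        \<not> (\<exists>Q\<in>real_quadrics. \<forall>i\<in>I. real_coords (z i) \<in> Q))"

(* "Almost every point" means outside a set that is Lebesgue null in every chart. *)

definition quadratically_nondegenerate ::
    "('m::topological_space, real^6) chart set \<Rightarrow>
     (('m, real^6) chart \<Rightarrow> real^6 \<Rightarrow> real^6 \<Rightarrow> real^6) \<Rightarrow>
     'i set \<Rightarrow> ('i \<Rightarrow> 'm set set) \<Rightarrow> bool" where
  "quadratically_nondegenerate A J I \<Phi> \<longleftrightarrow>
     (\<forall>c\<in>A. negligible (snd c ` {x \<in> fst c.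
        \<not> planes_quadratically_nondegenerate (J c (snd c x)) I
            (\<lambda>i. tangent_space c (leaf_through (\<Phi> i) x) x)}))"

end

theory Submission
  imports Defs
begin

text \<open>The Nijenhuis tensor \<open>N\<close> is bilinear over the functions, alternating, and conjugate-linear in each
argument. Fix a point and a complex basis \<open>e1, e2, e3\<close> of the tangent space there. Then \<open>N\<close> is
determined by the nine complex coordinates of \<open>N(e1,e2)\<close>, \<open>N(e1,e3)\<close> and \<open>N(e3,e2)\<close>.

The tangent planes of a pseudoholomorphic foliation are closed under brackets and under \<open>J\<close>, so \<open>N\<close>
maps pairs of vectors in such a plane into the plane (\<open>nijenhuis_tensor_in_tangent_space\<close>). For the
plane spanned by \<open>e1 + z1 e3\<close> and \<open>e2 + z2 e3\<close>, this invariance says that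
\<open>N(e1,e2) + cnj z2 N(e1,e3) + cnj z1 N(e3,e2)\<close> lies in the plane, which is one complex equation
whose nine monomials \<open>1, z1, z2, cnj z1, cnj z2, z1 cnj z1, z2 cnj z2, z1 cnj z2, z2 cnj z1\<close>
have, up to sign, the nine coordinates of \<open>N\<close> as coefficients. The real and imaginary parts of
this equation are real polynomials of degree at most two in the four real coordinates of the plane.
When the planes of the family do not lie on a common quadric, both polynomials are identically zero,
hence so are the nine coefficients, and \<open>N\<close> vanishes at the point
(\<open>antilinear_alternating_form_vanishes\<close>).

Thus \<open>N\<close> vanishes almost everywhere, and by continuity everywhere.

Closure under brackets comes from describing the leaves near a point as level sets of the transverse
part \<open>\<pi>\<close> of a foliation chart. Their tangent spaces are the kernels of \<open>D\<pi>\<close>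
(\<open>tangent_space_eq_kernel\<close>), and brackets of vector fields in these kernels stay there because
\<open>D\<^sup>2\<pi>\<close> is symmetric (\<open>lie_bracket_in_kernel\<close>).\<close>

section \<open>Differentiability of class C^k\<close>

lemma Ck_on_cong:
  assumes "open S" and "\<And>x. x \<in> S \<Longrightarrow> f x = g x" and "Ck_on k S f"
  shows "Ck_on k S g"
  using assms(2,3)
proof (induction k arbitrary: f g)
  case 0
  then show ?case by (auto cong: continuous_on_cong)
next
  case (Suc k)
  have d: "(g has_derivative frechet_derivative f (at x)) (at x)" if "x \<in> S" for x
  proof (rule has_derivative_transform_within_open[OF _ assms(1) that])
    show "(f has_derivative frechet_derivative f (at x)) (at x)"
      using Suc.prems(2) that frechet_derivative_works by auto
  qed (use Suc.prems in auto)
  have e: "frechet_derivative f (at x) = frechet_derivative g (at x)" if "x \<in> S" for x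
    using d[OF that] frechet_derivative_at by blast
  show ?case
    unfolding Ck_on.simps
  proof (intro conjI ballI allI)
    show "g differentiable at x" if "x \<in> S" for x
      using d[OF that] differentiableI by blast
    show "Ck_on k S (\<lambda>x. frechet_derivative g (at x) v)" for v
      by (rule Suc.IH[of "\<lambda>x. frechet_derivative f (at x) v"]) (use e Suc.prems in auto)
  qed
qed

lemma Ck_on_compose_line:
  fixes g :: "'a::euclidean_space \<Rightarrow> 'b::real_normed_vector"
  assumes "open W" "open I" and "\<And>s. s \<in> I \<Longrightarrow> p + s *\<^sub>R w \<in> W" and "Ck_on k W g"
  shows "Ck_on k I (\<lambda>s::real. g (p + s *\<^sub>R w))"
  using assms(4)
proof (induction k arbitrary: g)
  case 0
  have "continuous_on I (\<lambda>s. p + s *\<^sub>R w)" by (intro continuous_intros)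
  then show ?case using 0 assms(3)
    by (auto intro!: continuous_on_compose2[of W g])
next
  case (Suc k)
  have d: "((\<lambda>s. g (p + s *\<^sub>R w)) has_derivative
      (\<lambda>h. frechet_derivative g (at (p + s *\<^sub>R w)) (h *\<^sub>R w))) (at s)" if "s \<in> I" for s
  proof -
    have "(g has_derivative frechet_derivative g (at (p + s *\<^sub>R w))) (at (p + s *\<^sub>R w))"
      using Suc.prems assms(3)[OF that] frechet_derivative_works by auto
    moreover have "((\<lambda>s. p + s *\<^sub>R w) has_derivative (\<lambda>h. h *\<^sub>R w)) (at s)"
      by (auto intro!: derivative_eq_intros)
    ultimately show ?thesis by (rule has_derivative_compose[rotated])
  qed
  have e: "frechet_derivative (\<lambda>s. g (p + s *\<^sub>R w)) (at s) v
      = frechet_derivative g (at (p + s *\<^sub>R w)) (v *\<^sub>R w)" if "s \<in> I" for s v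
    using frechet_derivative_at[OF d[OF that]] by metis
  show ?case
    unfolding Ck_on.simps
  proof (intro conjI ballI allI)
    show "(\<lambda>s. g (p + s *\<^sub>R w)) differentiable at s" if "s \<in> I" for s
      using d[OF that] differentiableI by blast
    fix v :: real
    have "Ck_on k I (\<lambda>s. frechet_derivative g (at (p + s *\<^sub>R w)) (v *\<^sub>R w))"
      using Suc.prems by (intro Suc.IH) auto
    then show "Ck_on k I (\<lambda>s. frechet_derivative (\<lambda>s. g (p + s *\<^sub>R w)) (at s) v)"
      by (rule Ck_on_cong[OF assms(2), rotated]) (use e in auto)
  qed
qed

lemma Ck_on_snd: "open S \<Longrightarrow> Ck_on k S g \<Longrightarrow> Ck_on k S (\<lambda>u. snd (g u))"
proof (induction k arbitrary: g)
  case 0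
  then show ?case by (auto intro: continuous_on_snd)
next
  case (Suc k)
  have d: "((\<lambda>u. snd (g u)) has_derivative (\<lambda>h. snd (frechet_derivative g (at u) h))) (at u)"
    if "u \<in> S" for u
    using Suc.prems that frechet_derivative_works by (intro has_derivative_snd) auto
  show ?case
    unfolding Ck_on.simps
  proof (intro conjI ballI allI)
    show "(\<lambda>u. snd (g u)) differentiable at u" if "u \<in> S" for u
      using d[OF that] differentiableI by blast
    fix v
    have "Ck_on k S (\<lambda>u. snd (frechet_derivative g (at u) v))"
      using Suc.prems by (intro Suc.IH) auto
    then show "Ck_on k S (\<lambda>u. frechet_derivative (\<lambda>u. snd (g u)) (at u) v)"
      by (rule Ck_on_cong[OF Suc.prems(1), rotated]) (metis frechet_derivative_at[OF d])
  qed
qed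

lemma smooth_on_has_derivative:
  assumes "smooth_on S f" "x \<in> S"
  shows "(f has_derivative frechet_derivative f (at x)) (at x)"
proof -
  have "Ck_on (Suc 0) S f" using assms(1) unfolding smooth_on_def by blast
  then show ?thesis using assms(2) frechet_derivative_works by auto
qed

lemma smooth_on_frechet_derivative:
  assumes "smooth_on S f"
  shows "smooth_on S (\<lambda>x. frechet_derivative f (at x) v)"
  unfolding smooth_on_def
proof
  fix k
  have "Ck_on (Suc k) S f" using assms unfolding smooth_on_def by blast
  then show "Ck_on k S (\<lambda>x. frechet_derivative f (at x) v)" by auto
qed

lemma smooth_on_continuous: "smooth_on S f \<Longrightarrow> continuous_on S f"
  unfolding smooth_on_def using Ck_on.simps(1) by blast

section \<open>Symmetry of second derivatives\<close>

text \<open>Two applications of the one-dimensional mean value theorem, first in the direction of \<open>a\<close> and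
then in that of \<open>b\<close>. The left-hand side is symmetric in \<open>a\<close> and \<open>b\<close>, and that is what makes
mixed second derivatives agree.\<close>

lemma second_difference_mean_value:
  fixes f :: "'a::real_normed_vector \<Rightarrow> real"
  assumes f: "\<And>u. u \<in> U \<Longrightarrow> (f has_derivative f' u) (at u)"
    and fa: "\<And>u. u \<in> U \<Longrightarrow> ((\<lambda>v. f' v a) has_derivative f'' u) (at u)"
    and s: "s > 0"
    and rect: "\<And>r t. 0 \<le> r \<Longrightarrow> r \<le> s \<Longrightarrow> 0 \<le> t \<Longrightarrow> t \<le> s \<Longrightarrow> y + r *\<^sub>R a + t *\<^sub>R b \<in> U"
  obtains r t where "0 < r" "r < s" "0 < t" "t < s"
    "f (y + s *\<^sub>R a + s *\<^sub>R b) - f (y + s *\<^sub>R a) - f (y + s *\<^sub>R b) + f y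
       = s * s * f'' (y + r *\<^sub>R a + t *\<^sub>R b) b"
proof -
  \<comment> \<open>The second difference is the increment of \<open>g\<close> from \<open>0\<close> to \<open>s\<close>.\<close>
  define g where "g r = f (y + r *\<^sub>R a + s *\<^sub>R b) - f (y + r *\<^sub>R a)" for r
  have line: "((\<lambda>r. f (y + r *\<^sub>R a + t *\<^sub>R b)) has_derivative (\<lambda>h. h * f' (y + r *\<^sub>R a + t *\<^sub>R b) a)) (at r)"
    if "0 \<le> r" "r \<le> s" "0 \<le> t" "t \<le> s" for r t
  proof -
    have D: "(f has_derivative f' (y + r *\<^sub>R a + t *\<^sub>R b)) (at (y + r *\<^sub>R a + t *\<^sub>R b))"
      by (rule f[OF rect[OF that]])
    have "((\<lambda>r. y + r *\<^sub>R a + t *\<^sub>R b) has_derivative (\<lambda>h. h *\<^sub>R a)) (at r)"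
      by (auto intro!: derivative_eq_intros)
    from has_derivative_compose[OF this D] show ?thesis
      using linear_cmul[OF has_derivative_linear[OF D]] by (simp add: linear_cmul)
  qed
  have "\<exists>r\<in>{0<..<s}. g s - g 0 = (s - 0) * (f' (y + r *\<^sub>R a + s *\<^sub>R b) a - f' (y + r *\<^sub>R a) a)"
  proof -
    have "(g has_derivative (\<lambda>h. h * (f' (y + r *\<^sub>R a + s *\<^sub>R b) a - f' (y + r *\<^sub>R a) a))) (at r)"
      if "0 \<le> r" "r \<le> s" for r
      using has_derivative_diff[OF line[OF that, of s] line[OF that, of 0]] s
      unfolding g_def by (simp add: right_diff_distrib)
    then show ?thesis
      using mvt_simple[OF s, of g "\<lambda>r h. h * (f' (y + r *\<^sub>R a + s *\<^sub>R b) a - f' (y + r *\<^sub>R a) a)"]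
      by (auto intro: has_derivative_at_withinI)
  qed
  then obtain r where r: "0 < r" "r < s"
    and g: "g s - g 0 = s * (f' (y + r *\<^sub>R a + s *\<^sub>R b) a - f' (y + r *\<^sub>R a) a)" by auto
  define k where "k t = f' (y + r *\<^sub>R a + t *\<^sub>R b) a" for t
  have "(k has_derivative (\<lambda>h. h * f'' (y + r *\<^sub>R a + t *\<^sub>R b) b)) (at t)"
    if "0 \<le> t" "t \<le> s" for t
  proof -
    have D: "((\<lambda>v. f' v a) has_derivative f'' (y + r *\<^sub>R a + t *\<^sub>R b)) (at (y + r *\<^sub>R a + t *\<^sub>R b))"
      using r that by (intro fa rect) auto
    have "((\<lambda>t. y + r *\<^sub>R a + t *\<^sub>R b) has_derivative (\<lambda>h. h *\<^sub>R b)) (at t)"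
      by (auto intro!: derivative_eq_intros)
    from has_derivative_compose[OF this D] show ?thesis
      using linear_cmul[OF has_derivative_linear[OF D]] unfolding k_def by (simp add: linear_cmul)
  qed
  then have "\<exists>t\<in>{0<..<s}. k s - k 0 = (s - 0) * f'' (y + r *\<^sub>R a + t *\<^sub>R b) b"
    using mvt_simple[OF s, of k "\<lambda>t h. h * f'' (y + r *\<^sub>R a + t *\<^sub>R b) b"]
    by (auto intro: has_derivative_at_withinI)
  then obtain t where t: "0 < t" "t < s" "k s - k 0 = s * f'' (y + r *\<^sub>R a + t *\<^sub>R b) b"
    by auto
  show thesis
    by (rule that[OF r t(1,2)]) (use g t(3) in \<open>simp add: g_def k_def algebra_simps\<close>)
qed

text \<open>Schwarz's theorem. If the two mixed derivatives differed at \<open>y\<close>, continuity would keep them apart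
on a small parallelogram at \<open>y\<close>, but there each of them takes the value of one and the same second
difference quotient.\<close>

lemma second_derivative_symmetric_real:
  fixes f :: "'a::real_normed_vector \<Rightarrow> real"
  assumes U: "open U" "y \<in> U"
    and f: "\<And>u. u \<in> U \<Longrightarrow> (f has_derivative f' u) (at u)"
    and fa: "\<And>u. u \<in> U \<Longrightarrow> ((\<lambda>v. f' v a) has_derivative fa' u) (at u)"
    and fb: "\<And>u. u \<in> U \<Longrightarrow> ((\<lambda>v. f' v b) has_derivative fb' u) (at u)"
    and ca: "continuous_on U (\<lambda>u. fa' u b)" and cb: "continuous_on U (\<lambda>u. fb' u a)"
  shows "fa' y b = fb' y a"
proof (rule ccontr)
  assume "fa' y b \<noteq> fb' y a"
  define e where "e = dist (fa' y b) (fb' y a) / 2"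
  have e: "e > 0" using \<open>fa' y b \<noteq> fb' y a\<close> by (simp add: e_def)
  obtain d where d: "d > 0" "ball y d \<subseteq> U" using U open_contains_ball by blast
  obtain d1 where d1: "d1 > 0" "\<And>u. u \<in> U \<Longrightarrow> dist u y < d1 \<Longrightarrow> dist (fa' u b) (fa' y b) < e"
    using ca U(2) e unfolding continuous_on_iff by meson
  obtain d2 where d2: "d2 > 0" "\<And>u. u \<in> U \<Longrightarrow> dist u y < d2 \<Longrightarrow> dist (fb' u a) (fb' y a) < e"
    using cb U(2) e unfolding continuous_on_iff by meson
  define m where "m = Min {d, d1, d2}"
  have m: "m > 0" "m \<le> d" "m \<le> d1" "m \<le> d2" using d d1 d2 by (auto simp: m_def)
  \<comment> \<open>The parallelogram with sides \<open>s a\<close> and \<open>s b\<close> stays within distance \<open>m\<close> of \<open>y\<close>.\<close>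
  define s where "s = m / (2 * (norm a + norm b + 1))"
  have n: "norm a + norm b + 1 > 0" by (smt (verit) norm_ge_zero)
  have s: "s > 0" using m n by (simp add: s_def)
  have near: "dist (y + r *\<^sub>R a + t *\<^sub>R b) y < m" if "0 \<le> r" "r \<le> s" "0 \<le> t" "t \<le> s" for r t
  proof -
    have "dist (y + r *\<^sub>R a + t *\<^sub>R b) y = norm (r *\<^sub>R a + t *\<^sub>R b)"
      by (simp add: dist_norm algebra_simps)
    also have "\<dots> \<le> r * norm a + t * norm b"
      using norm_triangle_ineq[of "r *\<^sub>R a" "t *\<^sub>R b"] that by simp
    also have "\<dots> \<le> s * norm a + s * norm b"
      using that by (intro add_mono mult_right_mono) auto
    also have "\<dots> \<le> s * (norm a + norm b + 1)" using s by (simp add: algebra_simps)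
    also have "\<dots> = m / 2" using n unfolding s_def by (simp add: field_simps)
    also have "\<dots> < m" using m by simp
    finally show ?thesis .
  qed
  have rect: "y + r *\<^sub>R a + t *\<^sub>R b \<in> U" if "0 \<le> r" "r \<le> s" "0 \<le> t" "t \<le> s" for r t
    using near[OF that] m(2) d(2) by (auto simp: dist_commute subset_iff)
  obtain r t where A: "0 < r" "r < s" "0 < t" "t < s"
    "f (y + s *\<^sub>R a + s *\<^sub>R b) - f (y + s *\<^sub>R a) - f (y + s *\<^sub>R b) + f y
       = s * s * fa' (y + r *\<^sub>R a + t *\<^sub>R b) b"
    by (rule second_difference_mean_value[OF f fa s rect])
  obtain r' t' where B: "0 < r'" "r' < s" "0 < t'" "t' < s"
    "f (y + s *\<^sub>R b + s *\<^sub>R a) - f (y + s *\<^sub>R b) - f (y + s *\<^sub>R a) + f y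
       = s * s * fb' (y + r' *\<^sub>R b + t' *\<^sub>R a) a"
  proof (rule second_difference_mean_value[OF f fb s])
    show "y + r *\<^sub>R b + t *\<^sub>R a \<in> U" if "0 \<le> r" "r \<le> s" "0 \<le> t" "t \<le> s" for r t
      using rect[of t r] that by (simp add: algebra_simps)
  qed
  have "y + s *\<^sub>R b + s *\<^sub>R a = y + s *\<^sub>R a + s *\<^sub>R b" by simp
  then have "s * s * fa' (y + r *\<^sub>R a + t *\<^sub>R b) b = s * s * fb' (y + r' *\<^sub>R b + t' *\<^sub>R a) a"
    using A(5) B(5)[unfolded \<open>y + s *\<^sub>R b + s *\<^sub>R a = y + s *\<^sub>R a + s *\<^sub>R b\<close>] by linarith
  then have eq: "fa' (y + r *\<^sub>R a + t *\<^sub>R b) b = fb' (y + t' *\<^sub>R a + r' *\<^sub>R b) a"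
    using s by (simp add: algebra_simps)
  have "dist (fa' (y + r *\<^sub>R a + t *\<^sub>R b) b) (fa' y b) < e"
    using A near[of r t] rect[of r t] m by (intro d1(2)) auto
  moreover have "dist (fb' (y + t' *\<^sub>R a + r' *\<^sub>R b) a) (fb' y a) < e"
    using B near[of t' r'] rect[of t' r'] m by (intro d2(2)) auto
  ultimately have "dist (fa' y b) (fb' y a) < e + e"
    unfolding eq by (metis dist_commute dist_triangle_less_add)
  then show False by (simp add: e_def)
qed

lemma smooth_on_second_derivative_symmetric:
  fixes f :: "'a::euclidean_space \<Rightarrow> 'b::euclidean_space"
  assumes "open U" "y \<in> U" "smooth_on U f"
  shows "frechet_derivative (\<lambda>u. frechet_derivative f (at u) a) (at y) b
       = frechet_derivative (\<lambda>u. frechet_derivative f (at u) b) (at y) a"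
proof (rule euclidean_eqI)
  fix i :: 'b assume "i \<in> Basis"
  define D where "D u v = frechet_derivative f (at u) v" for u v
  have D1: "((\<lambda>u. f u \<bullet> i) has_derivative (\<lambda>h. D u h \<bullet> i)) (at u)" if "u \<in> U" for u
    unfolding D_def by (intro has_derivative_inner_left smooth_on_has_derivative[OF assms(3) that])
  have D2: "((\<lambda>u. D u v \<bullet> i) has_derivative (\<lambda>h. frechet_derivative (\<lambda>u. D u v) (at u) h \<bullet> i)) (at u)"
    if "u \<in> U" for u v
    unfolding D_def
    by (intro has_derivative_inner_left smooth_on_has_derivative[OF smooth_on_frechet_derivative[OF assms(3)] that])
  have D3: "continuous_on U (\<lambda>u. frechet_derivative (\<lambda>u. D u v) (at u) h \<bullet> i)" for v h
    unfolding D_def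
    by (intro continuous_intros smooth_on_continuous smooth_on_frechet_derivative assms(3))
  show "frechet_derivative (\<lambda>u. frechet_derivative f (at u) a) (at y) b \<bullet> i
       = frechet_derivative (\<lambda>u. frechet_derivative f (at u) b) (at y) a \<bullet> i"
    using second_derivative_symmetric_real[OF assms(1,2) D1 D2[where v=a] D2[where v=b] D3 D3]
    unfolding D_def by simp
qed

section \<open>Fields of linear maps\<close>

lemma linear_eq_sum_Basis:
  fixes L :: "'a::euclidean_space \<Rightarrow> 'b::real_vector"
  assumes "linear L"
  shows "L v = (\<Sum>b\<in>Basis. (v \<bullet> b) *\<^sub>R L b)"
proof -
  have "L v = L (\<Sum>b\<in>Basis. (v \<bullet> b) *\<^sub>R b)" by (simp add: euclidean_representation)
  also have "\<dots> = (\<Sum>b\<in>Basis. (v \<bullet> b) *\<^sub>R L b)"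
    using assms by (simp add: linear_sum linear_cmul)
  finally show ?thesis .
qed

text \<open>The product rule for a field of linear maps applied to a vector field. Only the pointwise
derivatives of \<open>u \<mapsto> L u v\<close> for fixed \<open>v\<close> are given; expanding the moving vector in a basis reduces
the rule to finitely many products.\<close>

lemma has_derivative_linear_field_apply:
  fixes L :: "'a::real_normed_vector \<Rightarrow> 'b::euclidean_space \<Rightarrow> 'c::real_normed_vector"
  assumes U: "open U" "y \<in> U"
    and lin: "\<And>u. u \<in> U \<Longrightarrow> linear (L u)"
    and L: "\<And>v. ((\<lambda>u. L u v) has_derivative L' v) (at y)"
    and X: "(X has_derivative X') (at y)"
  shows "((\<lambda>u. L u (X u)) has_derivative (\<lambda>h. L' (X y) h + L y (X' h))) (at y)"
proof (rule has_derivative_transform_within_open[OF _ U])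
  have linL': "L' v h = (\<Sum>b\<in>Basis. (v \<bullet> b) *\<^sub>R L' b h)" for v h
  proof -
    have "((\<lambda>u. L u v) has_derivative (\<lambda>h. \<Sum>b\<in>Basis. (v \<bullet> b) *\<^sub>R L' b h)) (at y)"
    proof (rule has_derivative_transform_within_open[OF _ U])
      show "((\<lambda>u. \<Sum>b\<in>Basis. (v \<bullet> b) *\<^sub>R L u b) has_derivative (\<lambda>h. \<Sum>b\<in>Basis. (v \<bullet> b) *\<^sub>R L' b h)) (at y)"
        by (intro has_derivative_sum has_derivative_scaleR_right L)
    qed (use lin linear_eq_sum_Basis in metis)
    from has_derivative_unique[OF L this] show ?thesis by metis
  qed
  have "((\<lambda>u. \<Sum>b\<in>Basis. (X u \<bullet> b) *\<^sub>R L u b) has_derivative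
      (\<lambda>h. \<Sum>b\<in>Basis. (X y \<bullet> b) *\<^sub>R L' b h + (X' h \<bullet> b) *\<^sub>R L y b)) (at y)"
    by (intro has_derivative_sum has_derivative_scaleR L has_derivative_inner_left X)
  moreover have "(\<Sum>b\<in>Basis. (X y \<bullet> b) *\<^sub>R L' b h + (X' h \<bullet> b) *\<^sub>R L y b) = L' (X y) h + L y (X' h)" for h
    using linL'[of "X y" h] linear_eq_sum_Basis[OF lin[OF U(2)], of "X' h"] by (simp add: sum.distrib)
  ultimately show "((\<lambda>u. \<Sum>b\<in>Basis. (X u \<bullet> b) *\<^sub>R L u b) has_derivative
      (\<lambda>h. L' (X y) h + L y (X' h))) (at y)" by simp
  show "(\<Sum>b\<in>Basis. (X u \<bullet> b) *\<^sub>R L u b) = L u (X u)" if "u \<in> U" for u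
    using linear_eq_sum_Basis[OF lin[OF that]] by metis
qed

lemma continuous_on_linear_field_apply:
  fixes L :: "'a::topological_space \<Rightarrow> 'b::euclidean_space \<Rightarrow> 'c::real_normed_vector"
  assumes lin: "\<And>u. u \<in> U \<Longrightarrow> linear (L u)"
    and L: "\<And>v. continuous_on U (\<lambda>u. L u v)"
    and X: "continuous_on U X"
  shows "continuous_on U (\<lambda>u. L u (X u))"
proof -
  have "continuous_on U (\<lambda>u. \<Sum>b\<in>Basis. (X u \<bullet> b) *\<^sub>R L u b)"
    by (intro continuous_intros L X)
  moreover have "(\<Sum>b\<in>Basis. (X u \<bullet> b) *\<^sub>R L u b) = L u (X u)" if "u \<in> U" for u
    using linear_eq_sum_Basis[OF lin[OF that]] by metis
  ultimately show ?thesis by (simp cong: continuous_on_cong)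
qed

section \<open>The Nijenhuis tensor\<close>

definition field_derivative :: "('e::real_normed_vector \<Rightarrow> 'e \<Rightarrow> 'e) \<Rightarrow> 'e \<Rightarrow> 'e \<Rightarrow> 'e \<Rightarrow> 'e" where
  "field_derivative j y h v = frechet_derivative (\<lambda>u. j u v) (at y) h"

text \<open>The value of the Nijenhuis tensor on two tangent vectors, with all derivatives falling on the
endomorphism field. The lemma \<open>nijenhuis_eq_tensor\<close> below derives this formula.\<close>

definition nijenhuis_tensor :: "('e::real_normed_vector \<Rightarrow> 'e \<Rightarrow> 'e) \<Rightarrow> 'e \<Rightarrow> 'e \<Rightarrow> 'e \<Rightarrow> 'e" where
  "nijenhuis_tensor j y \<xi> \<eta> =
     field_derivative j y (j y \<xi>) \<eta> - field_derivative j y (j y \<eta>) \<xi>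
     - j y (field_derivative j y \<xi> \<eta>) + j y (field_derivative j y \<eta> \<xi>)"

locale almost_complex_domain =
  fixes U :: "'e::euclidean_space set" and j :: "'e \<Rightarrow> 'e \<Rightarrow> 'e"
  assumes open_domain: "open U"
    and linear_j: "\<And>y. y \<in> U \<Longrightarrow> linear (j y)"
    and j_j: "\<And>y v. y \<in> U \<Longrightarrow> j y (j y v) = - v"
    and smooth_j: "\<And>v. smooth_on U (\<lambda>y. j y v)"
begin

lemma has_derivative_j:
  "y \<in> U \<Longrightarrow> ((\<lambda>u. j u v) has_derivative (\<lambda>h. field_derivative j y h v)) (at y)"
  unfolding field_derivative_def using smooth_on_has_derivative[OF smooth_j] by simp

lemma has_derivative_j_field:
  assumes "y \<in> U" "(X has_derivative X') (at y)"
  shows "((\<lambda>u. j u (X u)) has_derivative (\<lambda>h. field_derivative j y h (X y) + j y (X' h))) (at y)"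
  by (rule has_derivative_linear_field_apply[OF open_domain assms(1) linear_j has_derivative_j[OF assms(1)] assms(2)])

lemma linear_field_derivative_direction:
  assumes "y \<in> U"
  shows "linear (\<lambda>h. field_derivative j y h v)"
  using has_derivative_j[OF assms] has_derivative_linear by blast

lemma linear_field_derivative_argument:
  assumes y: "y \<in> U"
  shows "linear (field_derivative j y h)"
proof (rule linearI)
  fix v w :: 'e and r :: real
  have "((\<lambda>u. j u (v + w)) has_derivative
      (\<lambda>h. field_derivative j y h v + field_derivative j y h w)) (at y)"
    by (rule has_derivative_transform_within_open[OF has_derivative_add[OF has_derivative_j has_derivative_j] open_domain])
      (use y in \<open>auto simp: linear_add[OF linear_j]\<close>)
  from has_derivative_unique[OF has_derivative_j[OF y] this]
  show "field_derivative j y h (v + w) = field_derivative j y h v + field_derivative j y h w" by metis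
  have "((\<lambda>u. j u (r *\<^sub>R v)) has_derivative (\<lambda>h. r *\<^sub>R field_derivative j y h v)) (at y)"
    by (rule has_derivative_transform_within_open[OF has_derivative_scaleR_right[OF has_derivative_j] open_domain])
      (use y in \<open>auto simp: linear_cmul[OF linear_j]\<close>)
  from has_derivative_unique[OF has_derivative_j[OF y] this]
  show "field_derivative j y h (r *\<^sub>R v) = r *\<^sub>R field_derivative j y h v" by metis
qed

text \<open>Differentiate the identity \<open>j (j v) = - v\<close>, whose right-hand side is constant.\<close>

lemma field_derivative_anticommutes:
  assumes y: "y \<in> U"
  shows "field_derivative j y h (j y v) = - j y (field_derivative j y h v)"
proof -
  have "((\<lambda>u. - v) has_derivative
      (\<lambda>h. field_derivative j y h (j y v) + j y (field_derivative j y h v))) (at y)"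
    by (rule has_derivative_transform_within_open[OF has_derivative_j_field[OF y has_derivative_j[OF y]] open_domain y])
      (simp add: j_j)
  from has_derivative_unique[OF this has_derivative_const]
  have "field_derivative j y h (j y v) + j y (field_derivative j y h v) = 0" by metis
  then show ?thesis by (simp add: eq_neg_iff_add_eq_0)
qed

text \<open>Tensoriality: when the four brackets are expanded by the product rule, the terms with derivatives
of \<open>X\<close> and \<open>Y\<close> cancel in pairs because \<open>j (j v) = - v\<close>. Hence the vanishing of the Nijenhuis tensor
at a point can be tested on vectors there.\<close>

lemma nijenhuis_eq_tensor:
  assumes y: "y \<in> U" and X: "X differentiable at y" and Y: "Y differentiable at y"
  shows "nijenhuis j X Y y = nijenhuis_tensor j y (X y) (Y y)"
proof -
  define X' where "X' = frechet_derivative X (at y)"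
  define Y' where "Y' = frechet_derivative Y (at y)"
  have dX: "(X has_derivative X') (at y)" and dY: "(Y has_derivative Y') (at y)"
    using X Y frechet_derivative_works unfolding X'_def Y'_def by auto
  have "frechet_derivative (\<lambda>u. j u (X u)) (at y) = (\<lambda>h. field_derivative j y h (X y) + j y (X' h))"
    "frechet_derivative (\<lambda>u. j u (Y u)) (at y) = (\<lambda>h. field_derivative j y h (Y y) + j y (Y' h))"
    using frechet_derivative_at[OF has_derivative_j_field[OF y dX]]
      frechet_derivative_at[OF has_derivative_j_field[OF y dY]] by auto
  then show ?thesis
    unfolding nijenhuis_def nijenhuis_tensor_def lie_bracket_def X'_def[symmetric] Y'_def[symmetric]
    using j_j[OF y]
    by (simp add: linear_add[OF linear_j[OF y]] linear_diff[OF linear_j[OF y]] algebra_simps)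
qed

lemma nijenhuis_tensor_antisym:
  "nijenhuis_tensor j y \<eta> \<xi> = - nijenhuis_tensor j y \<xi> \<eta>"
  unfolding nijenhuis_tensor_def by simp

lemma nijenhuis_tensor_linear_left:
  assumes y: "y \<in> U"
  shows "linear (\<lambda>\<xi>. nijenhuis_tensor j y \<xi> \<eta>)"
  by (rule linearI; simp add: nijenhuis_tensor_def algebra_simps
      linear_add[OF linear_j[OF y]] linear_cmul[OF linear_j[OF y]]
      linear_add[OF linear_field_derivative_direction[OF y]] linear_cmul[OF linear_field_derivative_direction[OF y]]
      linear_add[OF linear_field_derivative_argument[OF y]] linear_cmul[OF linear_field_derivative_argument[OF y]])

text \<open>Conjugate-linearity is what turns membership of a value in a complex plane into an equation of
degree at most two in the real coordinates of the plane.\<close>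

lemma nijenhuis_tensor_antilinear_left:
  assumes y: "y \<in> U"
  shows "nijenhuis_tensor j y (j y \<xi>) \<eta> = - j y (nijenhuis_tensor j y \<xi> \<eta>)"
  unfolding nijenhuis_tensor_def
  by (simp add: j_j[OF y] field_derivative_anticommutes[OF y]
      linear_add[OF linear_j[OF y]] linear_diff[OF linear_j[OF y]]
      linear_neg[OF linear_j[OF y]] linear_neg[OF linear_field_derivative_direction[OF y]])

lemma continuous_on_nijenhuis_tensor:
  "continuous_on U (\<lambda>y. nijenhuis_tensor j y \<xi> \<eta>)"
proof -
  have c: "continuous_on U (\<lambda>y. j y v)" for v
    by (rule smooth_on_continuous[OF smooth_j])
  have d: "continuous_on U (\<lambda>y. field_derivative j y h v)" for h v
    unfolding field_derivative_def
    by (intro smooth_on_continuous smooth_on_frechet_derivative smooth_j)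
  have 1: "continuous_on U (\<lambda>y. field_derivative j y (j y v) w)" for v w
    using continuous_on_linear_field_apply[where L="\<lambda>y h. field_derivative j y h w" and X="\<lambda>y. j y v" and U=U]
      linear_field_derivative_direction d c by blast
  have 2: "continuous_on U (\<lambda>y. j y (field_derivative j y v w))" for v w
    using continuous_on_linear_field_apply[where L=j and X="\<lambda>y. field_derivative j y v w" and U=U]
      linear_j d c by blast
  show ?thesis unfolding nijenhuis_tensor_def by (intro continuous_intros 1 2)
qed

end

text \<open>The easy half of Frobenius' theorem. Differentiating \<open>D\<pi> (X) = 0\<close> along \<open>Y\<close> gives
\<open>D\<pi> (D\<^sub>Y X) = - D\<^sup>2\<pi> (X, Y)\<close>, and the right-hand side is symmetric in \<open>X\<close> and \<open>Y\<close>.\<close>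

lemma lie_bracket_in_kernel:
  fixes \<pi> :: "'e::euclidean_space \<Rightarrow> 'f::euclidean_space"
  assumes U: "open U" "y \<in> U" and \<pi>: "smooth_on U \<pi>"
    and X: "X differentiable at y" "\<And>u. u \<in> U \<Longrightarrow> frechet_derivative \<pi> (at u) (X u) = 0"
    and Y: "Y differentiable at y" "\<And>u. u \<in> U \<Longrightarrow> frechet_derivative \<pi> (at u) (Y u) = 0"
  shows "frechet_derivative \<pi> (at y) (lie_bracket X Y y) = 0"
proof -
  define D2 where "D2 v h = frechet_derivative (\<lambda>u. frechet_derivative \<pi> (at u) v) (at y) h" for v h
  have lin: "linear (frechet_derivative \<pi> (at u))" if "u \<in> U" for u
    using smooth_on_has_derivative[OF \<pi> that] has_derivative_linear by blast
  have D2: "((\<lambda>u. frechet_derivative \<pi> (at u) v) has_derivative D2 v) (at y)" for v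
    unfolding D2_def by (rule smooth_on_has_derivative[OF smooth_on_frechet_derivative[OF \<pi>] U(2), of v, simplified])
  have key: "frechet_derivative \<pi> (at y) (frechet_derivative Z (at y) h) = - D2 (Z y) h"
    if Z: "Z differentiable at y" "\<And>u. u \<in> U \<Longrightarrow> frechet_derivative \<pi> (at u) (Z u) = 0" for Z h
  proof -
    have "((\<lambda>u. frechet_derivative \<pi> (at u) (Z u)) has_derivative
        (\<lambda>h. D2 (Z y) h + frechet_derivative \<pi> (at y) (frechet_derivative Z (at y) h))) (at y)"
      by (rule has_derivative_linear_field_apply[OF U lin D2])
        (use Z(1) frechet_derivative_works in auto)
    then have "((\<lambda>u. 0) has_derivative
        (\<lambda>h. D2 (Z y) h + frechet_derivative \<pi> (at y) (frechet_derivative Z (at y) h))) (at y)"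
      by (rule has_derivative_transform_within_open[OF _ U]) (use Z(2) in auto)
    from has_derivative_unique[OF this has_derivative_const]
    have "D2 (Z y) h + frechet_derivative \<pi> (at y) (frechet_derivative Z (at y) h) = 0" by metis
    then show ?thesis by (simp add: eq_neg_iff_add_eq_0 add.commute)
  qed
  have "D2 (X y) (Y y) = D2 (Y y) (X y)"
    unfolding D2_def by (rule smooth_on_second_derivative_symmetric[OF U \<pi>])
  then show ?thesis
    unfolding lie_bracket_def linear_diff[OF lin[OF U(2)]]
    using key[OF X] key[OF Y] by simp
qed

text \<open>If the kernel distribution is invariant under \<open>j\<close>, then every bracket in the Nijenhuis expression,
and its image under \<open>j\<close>, is again tangent to it. Tensoriality converts this statement on vector
fields into one on vectors.\<close>

lemma (in almost_complex_domain) nijenhuis_tensor_in_kernel: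
  fixes \<pi> :: "'e \<Rightarrow> 'f::euclidean_space"
  assumes V: "open V" "V \<subseteq> U" "y \<in> V" and \<pi>: "smooth_on V \<pi>"
    and inv: "\<And>u v. u \<in> V \<Longrightarrow> frechet_derivative \<pi> (at u) v = 0 \<Longrightarrow>
                frechet_derivative \<pi> (at u) (j u v) = 0"
    and X: "X differentiable at y" "\<And>u. u \<in> V \<Longrightarrow> frechet_derivative \<pi> (at u) (X u) = 0"
    and Y: "Y differentiable at y" "\<And>u. u \<in> V \<Longrightarrow> frechet_derivative \<pi> (at u) (Y u) = 0"
  shows "frechet_derivative \<pi> (at y) (nijenhuis_tensor j y (X y) (Y y)) = 0"
proof -
  have y: "y \<in> U" using V by auto
  have lin: "linear (frechet_derivative \<pi> (at y))"
    using smooth_on_has_derivative[OF \<pi> V(3)] has_derivative_linear by blast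
  have jX: "(\<lambda>u. j u (X u)) differentiable at y" and jY: "(\<lambda>u. j u (Y u)) differentiable at y"
    using has_derivative_j_field[OF y] X(1) Y(1) unfolding differentiable_def by blast+
  note br = lie_bracket_in_kernel[OF V(1,3) \<pi>]
  have 1: "frechet_derivative \<pi> (at y) (lie_bracket (\<lambda>u. j u (X u)) (\<lambda>u. j u (Y u)) y) = 0"
    by (rule br[OF jX _ jY]) (use inv X(2) Y(2) in auto)
  have 2: "frechet_derivative \<pi> (at y) (j y (lie_bracket X (\<lambda>u. j u (Y u)) y)) = 0"
    by (rule inv[OF V(3) br[OF X jY]]) (use inv X(2) Y(2) in auto)
  have 3: "frechet_derivative \<pi> (at y) (j y (lie_bracket (\<lambda>u. j u (X u)) Y y)) = 0"
    by (rule inv[OF V(3) br[OF jX _ Y]]) (use inv X(2) Y(2) in auto)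
  have 4: "frechet_derivative \<pi> (at y) (lie_bracket X Y y) = 0"
    by (rule br[OF X Y])
  show ?thesis
    unfolding nijenhuis_eq_tensor[OF y X(1) Y(1), symmetric] nijenhuis_def linear_diff[OF lin]
    using 1 2 3 4 by simp
qed

section \<open>Conjugate-linear forms with many invariant planes\<close>

text \<open>The complex-valued polynomials of degree at most one in \<open>z\<close> and at most one in the conjugate of
\<open>z\<close>. They are the equations that a conjugate-linear alternating form imposes on its invariant planes.\<close>

definition bidegree_polynomial ::
    "complex \<Rightarrow> complex \<Rightarrow> complex \<Rightarrow> complex \<Rightarrow> complex \<Rightarrow> complex \<Rightarrow> complex \<Rightarrow> complex \<Rightarrow> complex
      \<Rightarrow> complex \<times> complex \<Rightarrow> complex" where
  "bidegree_polynomial k p1 q1 p2 q2 r1 r2 s t z =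
     k + cnj (fst z) * p1 + fst z * q1 + cnj (snd z) * p2 + snd z * q2
     + cnj (fst z) * fst z * r1 + cnj (snd z) * snd z * r2
     + fst z * cnj (snd z) * s + snd z * cnj (fst z) * t"

lemma vector_4_nth:
  fixes a b c d :: "'a::zero"
  shows "(vector [a, b, c, d] :: 'a^4) $ 1 = a" "(vector [a, b, c, d] :: 'a^4) $ 2 = b"
    "(vector [a, b, c, d] :: 'a^4) $ 3 = c" "(vector [a, b, c, d] :: 'a^4) $ 4 = d"
  unfolding vector_def by simp_all

text \<open>The real part is a real polynomial of degree at most two, so by non-degeneracy its coefficients
vanish. Since \<open>Re (cnj z * p + z * q) = Re (cnj z * (p + cnj q))\<close>, the coefficients of two conjugate
monomials enter only through \<open>p + cnj q\<close>.\<close>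

lemma real_part_vanishes_on_points:
  assumes nondeg: "\<not> (\<exists>Q\<in>real_quadrics. \<forall>i\<in>I. real_coords (z i) \<in> Q)"
    and zero: "\<And>i. i \<in> I \<Longrightarrow> Re (bidegree_polynomial k p1 q1 p2 q2 r1 r2 s t (z i)) = 0"
  shows "Re k = 0" "p1 = - cnj q1" "p2 = - cnj q2" "Re r1 = 0" "Re r2 = 0" "t = - cnj s"
proof -
  \<comment> \<open>\<open>\<alpha>\<close> and \<open>\<beta>\<close> are half the coefficients of \<open>Re (z1 cnj z2)\<close> and \<open>Im (z1 cnj z2)\<close>.\<close>
  define \<alpha> \<beta> where "\<alpha> = (Re s + Re t) / 2" and "\<beta> = (Im t - Im s) / 2"
  define b :: "real^4" where
    "b = vector [Re p1 + Re q1, Im p1 - Im q1, Re p2 + Re q2, Im p2 - Im q2]"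
  define C :: "real^4^4" where
    "C = vector [vector [Re r1, 0, \<alpha>, - \<beta>], vector [0, Re r1, \<beta>, \<alpha>],
                 vector [\<alpha>, \<beta>, Re r2, 0], vector [- \<beta>, \<alpha>, 0, Re r2]]"
  have sym: "transpose C = C"
    unfolding C_def transpose_def by (simp add: vec_eq_iff forall_4 vector_4_nth)
  have eval: "Re k + b \<bullet> real_coords w + real_coords w \<bullet> (C *v real_coords w)
      = Re (bidegree_polynomial k p1 q1 p2 q2 r1 r2 s t w)" for w
    unfolding b_def C_def real_coords_def bidegree_polynomial_def inner_vec_def matrix_vector_mult_def
    by (simp add: sum_4 vector_4_nth \<alpha>_def \<beta>_def field_simps)
  have "\<forall>i\<in>I. real_coords (z i) \<in> {u. Re k + b \<bullet> u + u \<bullet> (C *v u) = 0}"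
    using zero eval by simp
  then have z: "Re k = 0 \<and> b = 0 \<and> C = 0"
    using nondeg sym unfolding real_quadrics_def by blast
  show "Re k = 0" using z by simp
  have "b $ 1 = 0" "b $ 2 = 0" "b $ 3 = 0" "b $ 4 = 0" using z by simp_all
  note linear = this[unfolded b_def vector_4_nth]
  show "p1 = - cnj q1" by (rule complex_eqI) (use linear in \<open>simp_all, linarith?\<close>)
  show "p2 = - cnj q2" by (rule complex_eqI) (use linear in \<open>simp_all, linarith?\<close>)
  have "C $ 1 $ 1 = 0" "C $ 3 $ 3 = 0" "C $ 1 $ 3 = 0" "C $ 2 $ 3 = 0" using z by simp_all
  note quadratic = this[unfolded C_def vector_4_nth \<alpha>_def \<beta>_def]
  show "Re r1 = 0" "Re r2 = 0" using quadratic by simp_all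
  show "t = - cnj s" by (rule complex_eqI) (use quadratic in \<open>simp_all, linarith?\<close>)
qed

text \<open>Apply the previous lemma to the polynomial and to its product with \<open>\<i>\<close>. The two give
\<open>p = - cnj q\<close> and \<open>p = cnj q\<close> for each pair of conjugate monomials.\<close>

lemma bidegree_polynomial_vanishes_on_points:
  assumes nondeg: "\<not> (\<exists>Q\<in>real_quadrics. \<forall>i\<in>I. real_coords (z i) \<in> Q)"
    and zero: "\<And>i. i \<in> I \<Longrightarrow> bidegree_polynomial k p1 q1 p2 q2 r1 r2 s t (z i) = 0"
  shows "k = 0" "p1 = 0" "q1 = 0" "p2 = 0" "q2 = 0" "r1 = 0" "r2 = 0" "s = 0" "t = 0"
proof -
  have 1: "Re (bidegree_polynomial k p1 q1 p2 q2 r1 r2 s t (z i)) = 0" if "i \<in> I" for i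
    using zero[OF that] by simp
  have 2: "Re (bidegree_polynomial (\<i> * k) (\<i> * p1) (\<i> * q1) (\<i> * p2) (\<i> * q2) (\<i> * r1) (\<i> * r2)
      (\<i> * s) (\<i> * t) (z i)) = 0" if "i \<in> I" for i
  proof -
    have "bidegree_polynomial (\<i> * k) (\<i> * p1) (\<i> * q1) (\<i> * p2) (\<i> * q2) (\<i> * r1) (\<i> * r2)
      (\<i> * s) (\<i> * t) (z i) = \<i> * bidegree_polynomial k p1 q1 p2 q2 r1 r2 s t (z i)"
      unfolding bidegree_polynomial_def by (simp add: algebra_simps)
    then show ?thesis using zero[OF that] by simp
  qed
  note A = real_part_vanishes_on_points[OF nondeg 1] and B = real_part_vanishes_on_points[OF nondeg 2]
  have conj: "p = 0 \<and> q = 0" if "p = - cnj q" "\<i> * p = - cnj (\<i> * q)" for p q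
  proof -
    have "cnj q = - cnj q" using that by simp
    then show ?thesis using that(1) by simp
  qed
  show "k = 0" "r1 = 0" "r2 = 0"
    using A(1,4,5) B(1,4,5) by (simp_all add: complex_eq_iff)
  show "p1 = 0" "q1 = 0" using conj[OF A(2) B(2)] by simp_all
  show "p2 = 0" "q2 = 0" using conj[OF A(3) B(3)] by simp_all
  show "s = 0" "t = 0" using conj[OF A(6) B(6)] by simp_all
qed

locale complex_vector_space =
  fixes j :: "'e::real_vector \<Rightarrow> 'e"
  assumes linear_j: "linear j" and j_j: "\<And>v. j (j v) = - v"
begin

lemma cscale_add_right: "cscale j w (u + v) = cscale j w u + cscale j w v"
  unfolding cscale_def by (simp add: linear_add[OF linear_j] algebra_simps)

lemma cscale_add_left: "cscale j (w + w') u = cscale j w u + cscale j w' u"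
  unfolding cscale_def by (simp add: algebra_simps)

lemma cscale_cscale: "cscale j w (cscale j w' u) = cscale j (w * w') u"
  unfolding cscale_def by (simp add: linear_add[OF linear_j] linear_cmul[OF linear_j] j_j algebra_simps)

lemma cscale_0 [simp]: "cscale j 0 u = 0" "cscale j w 0 = 0" and cscale_1 [simp]: "cscale j 1 u = u"
  unfolding cscale_def by (simp_all add: linear_0[OF linear_j])

lemma complex_basis3_coordinates:
  assumes "complex_basis3 j e1 e2 e3"
  obtains a1 a2 a3 where "v = cscale j a1 e1 + cscale j a2 e2 + cscale j a3 e3"
proof -
  have "v \<in> range (\<lambda>(w1, w2, w3). cscale j w1 e1 + cscale j w2 e2 + cscale j w3 e3)"
    using assms unfolding complex_basis3_def bij_def by auto
  then show thesis using that by auto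
qed

lemma complex_basis3_unique:
  assumes "complex_basis3 j e1 e2 e3"
    and "cscale j a1 e1 + cscale j a2 e2 + cscale j a3 e3 = cscale j b1 e1 + cscale j b2 e2 + cscale j b3 e3"
  shows "a1 = b1 \<and> a2 = b2 \<and> a3 = b3"
proof -
  have "inj (\<lambda>(w1, w2, w3). cscale j w1 e1 + cscale j w2 e2 + cscale j w3 e3)"
    using assms(1) unfolding complex_basis3_def bij_def by auto
  from injD[OF this, of "(a1, a2, a3)" "(b1, b2, b3)"] show ?thesis using assms(2) by auto
qed

text \<open>In the affine chart, the plane with coordinates \<open>z\<close> is the graph of the linear form
\<open>(a1, a2) \<mapsto> z1 a1 + z2 a2\<close>.\<close>

lemma in_gr2_plane_iff:
  assumes "complex_basis3 j e1 e2 e3"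
  shows "cscale j a1 e1 + cscale j a2 e2 + cscale j a3 e3 \<in> gr2_plane j e1 e2 e3 z
    \<longleftrightarrow> a3 = fst z * a1 + snd z * a2"
proof -
  have "cscale j w1 (e1 + cscale j (fst z) e3) + cscale j w2 (e2 + cscale j (snd z) e3)
      = cscale j w1 e1 + cscale j w2 e2 + cscale j (fst z * w1 + snd z * w2) e3" for w1 w2
    by (simp add: cscale_add_right cscale_add_left cscale_cscale mult.commute)
  then have plane: "gr2_plane j e1 e2 e3 z
      = {cscale j w1 e1 + cscale j w2 e2 + cscale j (fst z * w1 + snd z * w2) e3 | w1 w2. True}"
    unfolding gr2_plane_def by simp
  show ?thesis
    unfolding plane using complex_basis3_unique[OF assms] by blast
qed

text \<open>The algebraic heart of the theorem. Over \<open>\<complex>\<close> the form is determined by its values on the three pairs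
of basis vectors, that is, by nine complex numbers. On the spanning vectors \<open>e1 + z1 e3\<close> and
\<open>e2 + z2 e3\<close> of a plane, its value is affine in the conjugates of \<open>z1\<close> and \<open>z2\<close>; membership of
this value in the plane is an equation of bidegree at most one in \<open>z\<close> and its conjugate, and its nine
coefficients are, up to sign, exactly these nine numbers.\<close>

lemma antilinear_alternating_form_vanishes:
  fixes N :: "'e \<Rightarrow> 'e \<Rightarrow> 'e"
  assumes N_linear: "\<And>v. linear (\<lambda>u. N u v)"
    and N_j: "\<And>u v. N (j u) v = - j (N u v)"
    and N_antisym: "\<And>u v. N v u = - N u v"
    and nondeg: "planes_quadratically_nondegenerate j I P"
    and inv: "\<And>i u v. i \<in> I \<Longrightarrow> u \<in> P i \<Longrightarrow> v \<in> P i \<Longrightarrow> N u v \<in> P i"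
  shows "N u v = 0"
proof -
  obtain e1 e2 e3 z where basis: "complex_basis3 j e1 e2 e3"
    and planes: "\<forall>i\<in>I. P i = gr2_plane j e1 e2 e3 (z i)"
    and z: "\<not> (\<exists>Q\<in>real_quadrics. \<forall>i\<in>I. real_coords (z i) \<in> Q)"
    using nondeg unfolding planes_quadratically_nondegenerate_def
    by (elim exE conjE) (rule that)
  note P = bspec[OF planes]
  have N_add: "N (u + u') v = N u v + N u' v" for u u' v
    by (rule linear_add[OF N_linear])
  have N_add': "N v (u + u') = N v u + N v u'" for u u' v
    unfolding N_antisym[where v=v] N_add by simp
  have N_cscale: "N (cscale j w u) v = cscale j (cnj w) (N u v)" for w u v
    unfolding cscale_def by (simp add: linear_add[OF N_linear] linear_cmul[OF N_linear] N_j)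
  have cscale_minus: "cscale j w (- u) = - cscale j w u" for w u
    unfolding cscale_def by (simp add: linear_neg[OF linear_j])
  have N_cscale': "N u (cscale j w v) = cscale j (cnj w) (N u v)" for w u v
    unfolding N_antisym[where v=u] N_cscale cscale_minus by simp
  have N_self: "N u u = 0" for u
  proof -
    have "2 *\<^sub>R N u u = 0"
      unfolding scaleR_2 by (rule eq_neg_iff_add_eq_0[THEN iffD1, OF N_antisym])
    then show ?thesis by simp
  qed
  obtain a1 a2 a3 where a: "N e1 e2 = cscale j a1 e1 + cscale j a2 e2 + cscale j a3 e3"
    using complex_basis3_coordinates[OF basis] .
  obtain b1 b2 b3 where b: "N e1 e3 = cscale j b1 e1 + cscale j b2 e2 + cscale j b3 e3"
    using complex_basis3_coordinates[OF basis] .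
  obtain c1 c2 c3 where c: "N e3 e2 = cscale j c1 e1 + cscale j c2 e2 + cscale j c3 e3"
    using complex_basis3_coordinates[OF basis] .
  have poly: "bidegree_polynomial a3 c3 (- a1) b3 (- a2) (- c1) (- b2) (- b1) (- c2) (z i) = 0"
    if i: "i \<in> I" for i
  proof -
    define x y where "x = fst (z i)" and "y = snd (z i)"
    have "e1 + cscale j x e3 \<in> P i" "e2 + cscale j y e3 \<in> P i"
      using in_gr2_plane_iff[OF basis, of 1 0 x "z i"] in_gr2_plane_iff[OF basis, of 0 1 y "z i"]
      unfolding P[OF i] x_def y_def by simp_all
    then have "N (e1 + cscale j x e3) (e2 + cscale j y e3) \<in> P i" by (rule inv[OF i])
    also have "N (e1 + cscale j x e3) (e2 + cscale j y e3)
        = N e1 e2 + cscale j (cnj y) (N e1 e3) + cscale j (cnj x) (N e3 e2)"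
      by (simp add: N_add N_add' N_cscale N_cscale' N_self)
    also have "\<dots> = cscale j (a1 + cnj y * b1 + cnj x * c1) e1 + cscale j (a2 + cnj y * b2 + cnj x * c2) e2
        + cscale j (a3 + cnj y * b3 + cnj x * c3) e3"
      unfolding a b c by (simp add: cscale_add_right cscale_add_left cscale_cscale)
    finally have "a3 + cnj y * b3 + cnj x * c3
        = x * (a1 + cnj y * b1 + cnj x * c1) + y * (a2 + cnj y * b2 + cnj x * c2)"
      unfolding P[OF i] x_def y_def using in_gr2_plane_iff[OF basis] by blast
    then show ?thesis
      unfolding bidegree_polynomial_def x_def[symmetric] y_def[symmetric] by (simp add: algebra_simps)
  qed
  have "a1 = 0" "a2 = 0" "a3 = 0" "b1 = 0" "b2 = 0" "b3 = 0" "c1 = 0" "c2 = 0" "c3 = 0"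
    using bidegree_polynomial_vanishes_on_points[OF z poly] by auto
  then have N0: "N e1 e2 = 0" "N e1 e3 = 0" "N e3 e2 = 0" using a b c by auto
  then have N0': "N e2 e1 = 0" "N e3 e1 = 0" "N e2 e3 = 0"
    using N_antisym[of e1 e2] N_antisym[of e1 e3] N_antisym[of e3 e2] by simp_all
  obtain u1 u2 u3 where u: "u = cscale j u1 e1 + cscale j u2 e2 + cscale j u3 e3"
    using complex_basis3_coordinates[OF basis] .
  obtain v1 v2 v3 where v: "v = cscale j v1 e1 + cscale j v2 e2 + cscale j v3 e3"
    using complex_basis3_coordinates[OF basis] .
  show "N u v = 0"
    unfolding u v by (simp add: N_add N_add' N_cscale N_cscale' N_self N0 N0')
qed

end

section \<open>Tangent spaces of leaves\<close>

lemma is_chart_inverse: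
  assumes "is_chart c"
  shows "p \<in> fst c \<Longrightarrow> chart_inv c (snd c p) = p"
  using assms unfolding is_chart_def homeomorphism_def by auto

lemma is_chart_open_image:
  assumes c: "is_chart c" and S: "open S"
  shows "open (snd c ` (fst c \<inter> S))"
proof -
  have "openin (top_of_set (snd c ` fst c)) (snd c ` (fst c \<inter> S))"
    using c S unfolding is_chart_def by (intro homeomorphism_imp_open_map) auto
  then show ?thesis using c unfolding is_chart_def by (auto intro: openin_open_trans)
qed

text \<open>For a foliation chart \<open>f\<close>, the map \<open>\<pi>\<close> is its transverse part read in the coordinates of \<open>c\<close>: the
plaques are its level sets, and their tangent spaces are the kernels of \<open>D\<pi>\<close>.\<close>

locale chart_pair =
  fixes c :: "('m::topological_space, 'e::euclidean_space) chart"
    and f :: "('m, 'f::euclidean_space \<times> 'g::euclidean_space) chart"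
  assumes chart_c: "is_chart c" and chart_f: "is_chart f"
    and compatible: "smoothly_compatible c f"
begin

definition domain_c :: "'e set" where "domain_c = snd c ` (fst c \<inter> fst f)"
definition domain_f :: "('f \<times> 'g) set" where "domain_f = snd f ` (fst c \<inter> fst f)"
abbreviation "\<phi> \<equiv> transition c f"
abbreviation "\<psi> \<equiv> transition f c"
definition \<pi> :: "'e \<Rightarrow> 'g" where "\<pi> u = snd (\<phi> u)"

lemma open_domains: "open domain_c" "open domain_f"
proof -
  show "open domain_c"
    unfolding domain_c_def using chart_c chart_f by (intro is_chart_open_image) (auto simp: is_chart_def)
  have "open (snd f ` (fst f \<inter> fst c))"
    using chart_c chart_f by (intro is_chart_open_image) (auto simp: is_chart_def)
  then show "open domain_f" unfolding domain_f_def by (simp add: Int_commute)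
qed

lemma domain_c_subset: "domain_c \<subseteq> snd c ` fst c" unfolding domain_c_def by auto

lemma transition_c_f: "p \<in> fst c \<Longrightarrow> \<phi> (snd c p) = snd f p"
  and transition_f_c: "p \<in> fst f \<Longrightarrow> \<psi> (snd f p) = snd c p"
  unfolding transition_def using is_chart_inverse[OF chart_c] is_chart_inverse[OF chart_f] by auto

lemma smooth_transitions: "smooth_on domain_c \<phi>" "smooth_on domain_f \<psi>"
  using compatible unfolding smoothly_compatible_def domain_c_def domain_f_def by auto

lemma transition_in_domain: "u \<in> domain_c \<Longrightarrow> \<phi> u \<in> domain_f"
  unfolding domain_c_def domain_f_def using transition_c_f by auto

lemma transition_inverse:
  "u \<in> domain_c \<Longrightarrow> \<psi> (\<phi> u) = u" "w \<in> domain_f \<Longrightarrow> \<phi> (\<psi> w) = w"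
  unfolding domain_c_def domain_f_def using transition_c_f transition_f_c by auto

abbreviation "D\<phi> u \<equiv> frechet_derivative \<phi> (at u)"
abbreviation "D\<psi> w \<equiv> frechet_derivative \<psi> (at w)"

lemma derivative_inverse_left:
  assumes u: "u \<in> domain_c"
  shows "D\<psi> (\<phi> u) (D\<phi> u v) = v"
proof -
  have "((\<lambda>u. \<psi> (\<phi> u)) has_derivative (\<lambda>h. D\<psi> (\<phi> u) (D\<phi> u h))) (at u)"
    by (rule has_derivative_compose[OF smooth_on_has_derivative[OF smooth_transitions(1) u]
          smooth_on_has_derivative[OF smooth_transitions(2) transition_in_domain[OF u]]])
  then have "((\<lambda>u. u) has_derivative (\<lambda>h. D\<psi> (\<phi> u) (D\<phi> u h))) (at u)"
    by (rule has_derivative_transform_within_open[OF _ open_domains(1) u]) (rule transition_inverse)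
  from has_derivative_unique[OF this has_derivative_ident] show ?thesis by metis
qed

lemma derivative_inverse_right:
  assumes u: "u \<in> domain_c"
  shows "D\<phi> u (D\<psi> (\<phi> u) w) = w"
proof -
  have "((\<lambda>w. \<phi> (\<psi> w)) has_derivative (\<lambda>h. D\<phi> u (D\<psi> (\<phi> u) h))) (at (\<phi> u))"
    by (rule has_derivative_compose[where g=\<phi> and f=\<psi>
          and g'="D\<phi> u" and f'="D\<psi> (\<phi> u)"])
      (use smooth_on_has_derivative[OF smooth_transitions(1) u]
          smooth_on_has_derivative[OF smooth_transitions(2) transition_in_domain[OF u]]
          transition_inverse(1)[OF u] in auto)
  then have "((\<lambda>u. u) has_derivative (\<lambda>h. D\<phi> u (D\<psi> (\<phi> u) h))) (at (\<phi> u))"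
    by (rule has_derivative_transform_within_open[OF _ open_domains(2) transition_in_domain[OF u]])
      (rule transition_inverse)
  from has_derivative_unique[OF this has_derivative_ident] show ?thesis by metis
qed

lemma has_derivative_\<pi>:
  assumes "u \<in> domain_c"
  shows "(\<pi> has_derivative (\<lambda>h. snd (D\<phi> u h))) (at u)"
  unfolding \<pi>_def
  by (intro has_derivative_snd smooth_on_has_derivative[OF smooth_transitions(1) assms])

lemma frechet_derivative_\<pi>: "u \<in> domain_c \<Longrightarrow> frechet_derivative \<pi> (at u) = (\<lambda>h. snd (D\<phi> u h))"
  using frechet_derivative_at[OF has_derivative_\<pi>] by simp

lemma smooth_\<pi>: "smooth_on domain_c \<pi>"
  using smooth_transitions(1) Ck_on_snd[OF open_domains(1)]
  unfolding smooth_on_def \<pi>_def by blast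

text \<open>A vector field that is constant in the foliation chart. For \<open>snd w = 0\<close> these fields extend any
tangent vector of a leaf to a vector field tangent to all leaves.\<close>

lemma constant_field:
  fixes w :: "'f \<times> 'g"
  defines "X \<equiv> (\<lambda>u. D\<psi> (\<phi> u) w)"
  assumes u: "u \<in> domain_c"
  shows "X differentiable at u" and "frechet_derivative \<pi> (at u) (X u) = snd w"
proof -
  have "((\<lambda>x. D\<psi> x w) has_derivative frechet_derivative (\<lambda>x. D\<psi> x w) (at (\<phi> u))) (at (\<phi> u))"
    by (rule smooth_on_has_derivative[OF smooth_on_frechet_derivative[OF smooth_transitions(2)]
        transition_in_domain[OF u]])
  from has_derivative_compose[OF smooth_on_has_derivative[OF smooth_transitions(1) u] this]
  show "X differentiable at u" unfolding X_def by (rule differentiableI)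
  show "frechet_derivative \<pi> (at u) (X u) = snd w"
    unfolding X_def frechet_derivative_\<pi>[OF u] derivative_inverse_right[OF u] ..
qed

text \<open>A curve in a leaf stays, for short time, in one component of the intersection of the leaf with the
foliation chart, so \<open>\<pi>\<close> is constant along it. Conversely, a vector in the kernel is the velocity of
a straight segment in the foliation chart, which lies in the plaque and hence in the leaf.\<close>

lemma tangent_space_eq_kernel:
  assumes plaques: "\<And>C. C \<in> components (L \<inter> fst f) \<Longrightarrow> \<exists>t. C = {p \<in> fst f. snd (snd f p) = t}"
    and x: "x \<in> L" "x \<in> fst c" "x \<in> fst f"
  shows "tangent_space c L x = {v. frechet_derivative \<pi> (at (snd c x)) v = 0}"
proof -
  define y where "y = snd c x"
  have y: "y \<in> domain_c" using x unfolding y_def domain_c_def by auto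
  have \<phi>y: "\<phi> y = snd f x" unfolding y_def using transition_c_f x(2) .
  have plaque: "C \<in> components (L \<inter> fst f) \<Longrightarrow> x \<in> C \<Longrightarrow> C = {p \<in> fst f. snd (snd f p) = snd (snd f x)}" for C
    using plaques[of C] by auto
  show ?thesis
    unfolding y_def[symmetric]
  proof (intro set_eqI iffI; unfold mem_Collect_eq)
    fix v assume "v \<in> tangent_space c L x"
    then obtain \<gamma> \<epsilon> where \<epsilon>: "\<epsilon> > 0" and \<gamma>0: "\<gamma> 0 = x"
      and \<gamma>: "\<gamma> ` {-\<epsilon><..<\<epsilon>} \<subseteq> L \<inter> fst c" and sm: "smooth_on {-\<epsilon><..<\<epsilon>} (snd c \<circ> \<gamma>)"
      and vel: "((snd c \<circ> \<gamma>) has_vector_derivative v) (at (0::real))"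
      unfolding tangent_space_def by blast
    have cont: "continuous_on {-\<epsilon><..<\<epsilon>} \<gamma>"
    proof -
      have "continuous_on {-\<epsilon><..<\<epsilon>} (\<lambda>s. chart_inv c ((snd c \<circ> \<gamma>) s))"
      proof (rule continuous_on_compose2[OF _ smooth_on_continuous[OF sm]])
        show "continuous_on (snd c ` fst c) (chart_inv c)"
          using chart_c unfolding is_chart_def homeomorphism_def by blast
      qed (use \<gamma> in auto)
      then show ?thesis
        by (rule continuous_on_eq)
          (use \<gamma> is_chart_inverse[OF chart_c] in \<open>simp add: image_subset_iff\<close>)
    qed
    have "open ({-\<epsilon><..<\<epsilon>} \<inter> \<gamma> -` fst f)"
      using cont chart_f unfolding is_chart_def
      by (intro continuous_open_preimage) auto
    moreover have "0 \<in> {-\<epsilon><..<\<epsilon>} \<inter> \<gamma> -` fst f" using \<epsilon> \<gamma>0 x by auto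
    ultimately obtain \<delta> where \<delta>: "\<delta> > 0" "ball 0 \<delta> \<subseteq> {-\<epsilon><..<\<epsilon>} \<inter> \<gamma> -` fst f"
      using open_contains_ball by metis
    have "connected (\<gamma> ` ball 0 \<delta>)"
      using \<delta> by (intro connected_continuous_image continuous_on_subset[OF cont]) auto
    moreover have "\<gamma> ` ball 0 \<delta> \<subseteq> L \<inter> fst f" using \<delta>(2) \<gamma> by auto
    moreover have "L \<inter> fst f \<noteq> {}" using x by auto
    ultimately obtain C where C: "C \<in> components (L \<inter> fst f)" "\<gamma> ` ball 0 \<delta> \<subseteq> C"
      using exists_component_superset by metis
    have "x \<in> C" using C(2) \<gamma>0 \<delta>(1) by (metis centre_in_ball image_subset_iff)
    then have "\<gamma> s \<in> {p \<in> fst f. snd (snd f p) = snd (snd f x)}" if "s \<in> ball 0 \<delta>" for s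
      using plaque[OF C(1)] C(2) that by blast
    moreover have "\<gamma> s \<in> fst c" if "s \<in> ball 0 \<delta>" for s using that \<delta>(2) \<gamma> by blast
    ultimately have const: "\<pi> ((snd c \<circ> \<gamma>) s) = snd (snd f x)" if "s \<in> ball 0 \<delta>" for s
      using that transition_c_f unfolding \<pi>_def by simp
    have "(\<pi> has_derivative frechet_derivative \<pi> (at y)) (at ((snd c \<circ> \<gamma>) 0))"
      using smooth_on_has_derivative[OF smooth_\<pi> y] \<gamma>0 by (simp add: y_def)
    from has_derivative_compose[OF vel[unfolded has_vector_derivative_def] this]
    have "((\<lambda>s. snd (snd f x)) has_derivative (\<lambda>h. frechet_derivative \<pi> (at y) (h *\<^sub>R v))) (at (0::real))"
      by (rule has_derivative_transform_within_open[OF _ open_ball[of 0 \<delta>]]) (use const \<delta>(1) in auto)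
    from has_derivative_unique[OF this has_derivative_const]
    have "frechet_derivative \<pi> (at y) (1 *\<^sub>R v) = 0" by metis
    then show "frechet_derivative \<pi> (at y) v = 0" by simp
  next
    fix v assume v: "frechet_derivative \<pi> (at y) v = 0"
    define w where "w = D\<phi> y v"
    have snd_w: "snd w = 0" using v unfolding w_def frechet_derivative_\<pi>[OF y] .
    have fx: "snd f x \<in> domain_f" using x unfolding domain_f_def by auto
    have "open ((\<lambda>s::real. snd f x + s *\<^sub>R w) -` domain_f)"
      by (intro continuous_open_vimage open_domains) (auto intro!: continuous_intros)
    moreover have "0 \<in> (\<lambda>s::real. snd f x + s *\<^sub>R w) -` domain_f" using fx by simp
    ultimately obtain \<epsilon> where \<epsilon>: "\<epsilon> > 0" "ball 0 \<epsilon> \<subseteq> (\<lambda>s::real. snd f x + s *\<^sub>R w) -` domain_f"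
      using open_contains_ball by metis
    have I: "{-\<epsilon><..<\<epsilon>} = ball (0::real) \<epsilon>" by (auto simp: dist_real_def)
    define \<gamma> where "\<gamma> s = chart_inv f (snd f x + s *\<^sub>R w)" for s :: real
    have line: "snd f x + s *\<^sub>R w \<in> domain_f" if "s \<in> {-\<epsilon><..<\<epsilon>}" for s
      using that \<epsilon>(2) unfolding I by auto
    have \<gamma>0: "\<gamma> 0 = x" unfolding \<gamma>_def using is_chart_inverse[OF chart_f x(3)] by simp
    have \<gamma>c: "snd c \<circ> \<gamma> = (\<lambda>s. \<psi> (snd f x + s *\<^sub>R w))" unfolding \<gamma>_def transition_def by auto
    have "\<gamma> s \<in> L \<inter> fst c" if s: "s \<in> {-\<epsilon><..<\<epsilon>}" for s
    proof -
      obtain p where p: "p \<in> fst c" "p \<in> fst f" "snd f x + s *\<^sub>R w = snd f p"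
        using line[OF s] unfolding domain_f_def by auto
      have "\<gamma> s = p" unfolding \<gamma>_def p(3) by (rule is_chart_inverse[OF chart_f p(2)])
      have "snd (snd f p) = snd (snd f x)" unfolding p(3)[symmetric] using snd_w by simp
      moreover have "x \<in> L \<inter> fst f" using x by simp
      then obtain C where C: "C \<in> components (L \<inter> fst f)" "x \<in> C" by (metis UnionE Union_components)
      ultimately have "p \<in> C" using plaque[OF C] p(2) by simp
      then have "p \<in> L" using C(1) in_components_subset by blast
      then show ?thesis using \<open>\<gamma> s = p\<close> p(1) by simp
    qed
    moreover have "smooth_on {-\<epsilon><..<\<epsilon>} (snd c \<circ> \<gamma>)"
      unfolding smooth_on_def \<gamma>c
    proof
      fix k
      show "Ck_on k {-\<epsilon><..<\<epsilon>} (\<lambda>s. \<psi> (snd f x + s *\<^sub>R w))"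
        using smooth_transitions(2) unfolding smooth_on_def
        by (intro Ck_on_compose_line[OF open_domains(2) open_greaterThanLessThan line]) auto
    qed
    moreover have "((snd c \<circ> \<gamma>) has_vector_derivative v) (at 0)"
    proof -
      have "((\<lambda>s::real. snd f x + s *\<^sub>R w) has_derivative (\<lambda>h. h *\<^sub>R w)) (at 0)"
        by (auto intro!: derivative_eq_intros)
      moreover have D: "(\<psi> has_derivative D\<psi> (snd f x)) (at (snd f x + 0 *\<^sub>R w))"
        using smooth_on_has_derivative[OF smooth_transitions(2) fx] by simp
      ultimately have "(snd c \<circ> \<gamma> has_derivative (\<lambda>h. D\<psi> (snd f x) (h *\<^sub>R w))) (at 0)"
        unfolding \<gamma>c by (rule has_derivative_compose)
      moreover have "D\<psi> (snd f x) (h *\<^sub>R w) = h *\<^sub>R v" for h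
        using derivative_inverse_left[OF y, of v] linear_cmul[OF has_derivative_linear[OF D]]
        unfolding \<phi>y w_def by simp
      ultimately show ?thesis unfolding has_vector_derivative_def by simp
    qed
    ultimately show "v \<in> tangent_space c L x"
      unfolding tangent_space_def using \<epsilon>(1) \<gamma>0 by blast
  qed
qed

end

lemma leaf_through_eq:
  assumes "pairwise disjnt F" "L \<in> F" "x \<in> L"
  shows "leaf_through F x = L"
  unfolding leaf_through_def
  by (rule the_equality) (use assms in \<open>auto simp: pairwise_def disjnt_def\<close>)

lemma almost_complex_domain_chart:
  assumes "smooth_atlas A" "almost_complex_structure A J" "c \<in> A"
  shows "almost_complex_domain (snd c ` fst c) (J c)"
  using assms unfolding smooth_atlas_def is_chart_def almost_complex_structure_def
  by (intro almost_complex_domain.intro) auto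

text \<open>Near \<open>x\<close> the tangent spaces of the leaves are the kernels of \<open>D\<pi>\<close> for a single foliation chart, so
the foliation being pseudoholomorphic makes this kernel distribution \<open>J\<close>-invariant, and
\<open>nijenhuis_tensor_in_kernel\<close> applies.\<close>

lemma nijenhuis_tensor_in_tangent_space:
  fixes A :: "('m::topological_space, real^6) chart set"
  assumes atlas: "smooth_atlas A" and J: "almost_complex_structure A J"
    and F: "ph_foliation A J F" and c: "c \<in> A" and x: "x \<in> fst c"
    and v: "v \<in> tangent_space c (leaf_through F x) x" and w: "w \<in> tangent_space c (leaf_through F x) x"
  shows "nijenhuis_tensor (J c) (snd c x) v w \<in> tangent_space c (leaf_through F x) x"
proof -
  interpret almost_complex_domain "snd c ` fst c" "J c"
    by (rule almost_complex_domain_chart[OF atlas J c])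
  have fol: "foliation_4_6 A F"
    and inv: "\<And>L p. L \<in> F \<Longrightarrow> p \<in> L \<inter> fst c \<Longrightarrow>
        J c (snd c p) ` tangent_space c L p \<subseteq> tangent_space c L p"
    using F c unfolding ph_foliation_def by auto
  obtain f :: "('m, (real^4) \<times> (real^2)) chart" where f: "is_chart f" "x \<in> fst f" "smoothly_compatible c f"
    and plaques: "\<And>L C. L \<in> F \<Longrightarrow> C \<in> components (L \<inter> fst f) \<Longrightarrow> \<exists>t. C = {p \<in> fst f. snd (snd f p) = t}"
    using fol c unfolding foliation_4_6_def by meson
  interpret chart_pair c f
    using atlas c f unfolding smooth_atlas_def by unfold_locales auto
  have leaf: "\<exists>L\<in>F. p \<in> L" for p
    using fol unfolding foliation_4_6_def by auto
  have kernel: "tangent_space c L p = {v. frechet_derivative \<pi> (at (snd c p)) v = 0}"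
    if "L \<in> F" "p \<in> L" "p \<in> fst c" "p \<in> fst f" for L p
    using tangent_space_eq_kernel[OF plaques[OF that(1)] that(2-4)] .
  obtain L where L: "L \<in> F" "x \<in> L" using leaf by blast
  have lt: "leaf_through F x = L"
    using fol L unfolding foliation_4_6_def by (intro leaf_through_eq) auto
  define y where "y = snd c x"
  have y: "y \<in> domain_c" unfolding y_def domain_c_def using x f(2) by auto
  have tan: "tangent_space c (leaf_through F x) x = {v. frechet_derivative \<pi> (at y) v = 0}"
    unfolding lt y_def by (rule kernel[OF L x f(2)])
  \<comment> \<open>Extend each tangent vector by the field constant in the foliation chart.\<close>
  define X where "X v u = D\<psi> (\<phi> u) (D\<phi> y v)" for v u
  have X: "X v differentiable at u" "frechet_derivative \<pi> (at u) (X v u) = 0"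
    if "frechet_derivative \<pi> (at y) v = 0" "u \<in> domain_c" for v u
    using constant_field[OF that(2), of "D\<phi> y v"] that(1) frechet_derivative_\<pi>[OF y]
    unfolding X_def by auto
  have Xy: "X v y = v" for v unfolding X_def by (rule derivative_inverse_left[OF y])
  have kinv: "frechet_derivative \<pi> (at u) (J c u v) = 0"
    if "u \<in> domain_c" "frechet_derivative \<pi> (at u) v = 0" for u v
  proof -
    obtain p where p: "p \<in> fst c" "p \<in> fst f" "u = snd c p" using \<open>u \<in> domain_c\<close> unfolding domain_c_def by auto
    obtain L where L: "L \<in> F" "p \<in> L" using leaf by blast
    show ?thesis using inv[OF L(1), of p] kernel[OF L p(1,2)] L(2) p that(2) by auto
  qed
  have "frechet_derivative \<pi> (at y) (nijenhuis_tensor (J c) y (X v y) (X w y)) = 0"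
    by (rule nijenhuis_tensor_in_kernel[OF open_domains(1) domain_c_subset y smooth_\<pi> kinv])
      (use X y v w in \<open>auto simp: tan\<close>)
  then show ?thesis unfolding tan Xy y_def[symmetric] by simp
qed

section \<open>Integrability\<close>

lemma zero_off_negligible:
  fixes g :: "'a::euclidean_space \<Rightarrow> 'b::real_normed_vector"
  assumes "open S" "continuous_on S g" "negligible N" "\<And>y. y \<in> S - N \<Longrightarrow> g y = 0" "y \<in> S"
  shows "g y = 0"
proof (rule ccontr)
  assume "g y \<noteq> 0"
  have "open (S \<inter> g -` (- {0}))"
    using assms(1,2) by (intro continuous_open_preimage) auto
  moreover have "S \<inter> g -` (- {0}) \<subseteq> N" using assms(4) by auto
  then have "negligible (S \<inter> g -` (- {0}))" using assms(3) negligible_subset by blast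
  ultimately have "S \<inter> g -` (- {0}) = {}" using open_not_negligible by blast
  then show False using \<open>g y \<noteq> 0\<close> assms(5) by auto
qed

theorem theorem5:
  fixes A :: "('m::{t2_space,second_countable_topology}, real^6) chart set"
    and J :: "('m, real^6) chart \<Rightarrow> real^6 \<Rightarrow> real^6 \<Rightarrow> real^6"
    and \<Phi> :: "nat \<Rightarrow> 'm set set"
  assumes "smooth_atlas A"
    and "almost_complex_structure A J"
    and "\<And>\<alpha>. \<alpha> \<in> {1..15} \<Longrightarrow> ph_foliation A J (\<Phi> \<alpha>)"
    and "quadratically_nondegenerate A J {1..15} \<Phi>"
  shows "integrable_structure A J"
  unfolding integrable_structure_def
proof (intro ballI allI impI)
  fix c and X Y :: "real^6 \<Rightarrow> real^6" and y
  assume c: "c \<in> A" and X: "smooth_on (snd c ` fst c) X" and Y: "smooth_on (snd c ` fst c) Y"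
    and y: "y \<in> snd c ` fst c"
  interpret almost_complex_domain "snd c ` fst c" "J c"
    by (rule almost_complex_domain_chart[OF assms(1,2) c])
  define bad where "bad = snd c ` {x \<in> fst c.
        \<not> planes_quadratically_nondegenerate (J c (snd c x)) {1..15::nat}
            (\<lambda>i. tangent_space c (leaf_through (\<Phi> i) x) x)}"
  have bad: "negligible bad"
    using assms(4) c unfolding quadratically_nondegenerate_def bad_def by blast
  have good: "nijenhuis_tensor (J c) u v w = 0" if u: "u \<in> snd c ` fst c - bad" for u v w
  proof -
    obtain x where x: "x \<in> fst c" "u = snd c x" using u by auto
    have nondeg: "planes_quadratically_nondegenerate (J c u) {1..15::nat}
            (\<lambda>i. tangent_space c (leaf_through (\<Phi> i) x) x)"
      using u x unfolding bad_def by auto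
    have U: "u \<in> snd c ` fst c" using u by simp
    interpret complex_vector_space "J c u"
      by (rule complex_vector_space.intro) (use linear_j j_j U in auto)
    show ?thesis
    proof (rule antilinear_alternating_form_vanishes[where N = "nijenhuis_tensor (J c) u", OF _ _ _ nondeg])
      show "linear (\<lambda>v. nijenhuis_tensor (J c) u v w)" for w
        by (rule nijenhuis_tensor_linear_left[OF U])
      show "nijenhuis_tensor (J c) u (J c u v) w = - J c u (nijenhuis_tensor (J c) u v w)" for v w
        by (rule nijenhuis_tensor_antilinear_left[OF U])
      show "nijenhuis_tensor (J c) u w v = - nijenhuis_tensor (J c) u v w" for v w
        by (rule nijenhuis_tensor_antisym)
      show "nijenhuis_tensor (J c) u v w \<in> tangent_space c (leaf_through (\<Phi> i) x) x"
        if "i \<in> {1..15}" "v \<in> tangent_space c (leaf_through (\<Phi> i) x) x"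
          "w \<in> tangent_space c (leaf_through (\<Phi> i) x) x" for i v w
        unfolding x(2) by (rule nijenhuis_tensor_in_tangent_space[OF assms(1,2) assms(3)[OF that(1)] c x(1) that(2,3)])
    qed
  qed
  have "nijenhuis (J c) X Y y = nijenhuis_tensor (J c) y (X y) (Y y)"
    using smooth_on_has_derivative[OF X y] smooth_on_has_derivative[OF Y y]
    by (intro nijenhuis_eq_tensor[OF y]) (blast intro: differentiableI)+
  also have "\<dots> = 0"
    by (rule zero_off_negligible[OF open_domain continuous_on_nijenhuis_tensor bad good y])
  finally show "nijenhuis (J c) X Y y = 0" .
qed

end
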